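(* Let $X$ be a separable Banach space. The following are equivalent: (i) $X^\ast$ is non-separable; (ii) for every $\epsilon>0$ there exists a bounded linear operator $T:X\to C(\{0,1\}^\omega)$ with $\|T\|\le 1+\epsilon$ and $\{\chi_{\Delta_t}:t\in\mathcal{D}\}\subseteq T(B_X)$; (iii) for every $\epsilon>0$ there exists a bounded linear operator $R:X\to C(\{0,1\}^\omega)$ with $\|R\|\le 2+\epsilon$ and $\{h_m:m\ge 0\}\subseteq R(B_X)$.
   Context: $B_X$ is the closed unit ball of $X$. $\{0,1\}^\omega$ is the Cantor set with product topology; $\mathcal{D}=\bigcup_{n<\omega}\{0,1\}^n$ is the set of finite sequences in $\{0,1\}$; for $t\in\mathcal{D}$, $\Delta_t$ is the set of $s\in\{0,1\}^\omega$ having $t$ as initial segment, and $t^\frown i$ is $t$ with $i$ appended. The Haar functions are $h_0=\chi_{\{0,1\}^\omega}$ together with the functions $\chi_{\Delta_{t^\frown0}}-\chi_{\Delta_{t^\frown1}}$, $t\in\mathcal{D}$ (indexed as $h_m$, $m\ge1$, via a fixed enumeration of $\mathcal{D}$). *)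

theory Defs
  imports "HOL-Analysis.Analysis"
begin

text \<open>The Cantor set {0,1}^omega is modelled as the type nat \<Rightarrow> bool with the
product topology (bool carries the discrete topology); C({0,1}^omega) is the
Banach space bcontfun (nat => bool) real of (bounded) continuous real functions
with the sup norm. Finite sequences in {0,1} are bool lists.\<close>

type_synonym cantor = "nat \<Rightarrow> bool"

definition Delta :: "bool list \<Rightarrow> cantor set" where
  "Delta t = {s. \<forall>i < length t. s i = t ! i}"

definition chiDelta :: "bool list \<Rightarrow> cantor \<Rightarrow> real" where
  "chiDelta t = indicator (Delta t)"

definition haar0 :: "cantor \<Rightarrow> real" where
  "haar0 = indicator (UNIV :: cantor set)"

definition haar :: "bool list \<Rightarrow> cantor \<Rightarrow> real" where
  "haar t = (\<lambda>s. chiDelta (t @ [False]) s - chiDelta (t @ [True]) s)"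

end

theory Submission
  imports Defs
begin

text \<open>Suppose that the dual of X is non-separable. Call a set of functionals fat if no countable set
has a linear span coming within distance 1 of each of its members; non-fat sets form a sigma-ideal,
and every ball of radius greater than 1 is fat. As bounded sets of functionals are second countable
for the weak* topology, a bounded fat set contains one all of whose non-empty relatively weak*
open subsets are fat. Given finitely many such sets, pick a functional k in each, and in one of
them a further functional m at distance more than 1 from the span of the k's. A Hahn--Banach
argument for subspaces of finite codimension gives a vector x of the unit ball with m x = 1 that is
annihilated by all the k's. After shrinking the sets around these functionals, the values at x are
almost 0 or 1, and subtracting a small multiple of g = m - k, for the k of the set containing m,
makes them exactly 0 or 1. Earlier vectors at which each set took a single value are annihilated
by g, so exactness there is preserved. Repeating this along the dyadic tree with summable errors
gives weak* limits along the branches, depending weak* continuously on the branch, and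
evaluation at them is the required operator T. The operator 2 T then hits the Haar
functions, because their preimages are halves of differences of vectors of the unit ball. Conversely,
point evaluations composed with an operator that hits the Haar functions form an uncountable
2-separated set in the dual.\<close>

section \<open>A finite-codimensional Hahn--Banach theorem\<close>

text \<open>Induction on \<open>Z\<close>, one functional at a time. Passing from the annihilator of
  \<open>insert z Z\<close> to that of \<open>Z\<close> adds at most one dimension, and the
  one-dimensional Hahn-Banach step supplies a number \<open>l\<close> for which
  \<open>f - l *\<^sub>R z\<close> still satisfies the bound on the larger subspace. For
  \<open>Z = {}\<close> the bound holds on the whole space.\<close>

lemma annihilator_extension:
  fixes f :: "'a::real_normed_vector \<Rightarrow>\<^sub>L real" and Z :: "('a \<Rightarrow>\<^sub>L real) set"
  assumes "finite Z" and "\<And>x. (\<forall>z\<in>Z. z x = 0) \<Longrightarrow> \<bar>f x\<bar> \<le> norm x"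
  shows "\<exists>g\<in>span Z. norm (f - g) \<le> 1"
  using assms
proof (induction Z arbitrary: f rule: finite_induct)
  case empty
  then have "norm f \<le> 1"
    by (intro norm_blinfun_bound) auto
  then show ?case by auto
next
  case (insert z Z)
  \<comment> \<open>By homogeneity the bound for \<open>f - l *\<^sub>R z\<close> need only be
    checked on this slice, where it reads \<open>\<bar>f w - l\<bar> \<le> norm w\<close>. If the
    slice is empty, \<open>z\<close> vanishes on the annihilator of \<open>Z\<close> and
    \<open>l = 0\<close> works.\<close>
  define W where "W = {w. (\<forall>z'\<in>Z. z' w = 0) \<and> z w = 1}"
  have "\<exists>l. \<forall>x. (\<forall>z'\<in>Z. z' x = 0) \<longrightarrow> \<bar>(f - l *\<^sub>R z) x\<bar> \<le> norm x"
  proof (cases "W = {}")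
    case True
    have "\<bar>(f - 0 *\<^sub>R z) x\<bar> \<le> norm x" if x: "\<forall>z'\<in>Z. z' x = 0" for x
    proof -
      have "z x = 0"
      proof (rule ccontr)
        assume "z x \<noteq> 0"
        then have "(1 / z x) *\<^sub>R x \<in> W"
          using x by (auto simp: W_def blinfun.scaleR_right)
        with True show False by auto
      qed
      then show ?thesis using insert.prems x by auto
    qed
    then show ?thesis by blast
  next
    case False
    \<comment> \<open>The difference \<open>w - w'\<close> is annihilated by \<open>z\<close> as
      well, so the hypothesis applies to it. Hence the intervals from \<open>f w - norm w\<close> to
      \<open>f w + norm w\<close> meet pairwise, and the supremum \<open>l\<close> of their left
      ends lies in all of them.\<close>
    have sep: "f w - norm w \<le> f w' + norm w'" if "w \<in> W" "w' \<in> W" for w w'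
    proof -
      have "\<bar>f (w - w')\<bar> \<le> norm (w - w')"
        using that by (intro insert.prems) (auto simp: W_def blinfun.diff_right)
      also have "\<dots> \<le> norm w + norm w'" by (rule norm_triangle_ineq4)
      finally show ?thesis by (simp add: blinfun.diff_right)
    qed
    define l where "l = (SUP w\<in>W. f w - norm w)"
    have lower: "f w - norm w \<le> l" if "w \<in> W" for w
      unfolding l_def using that False sep by (intro cSUP_upper bdd_aboveI2) auto
    have upper: "l \<le> f w + norm w" if "w \<in> W" for w
      unfolding l_def using that False sep by (intro cSUP_least) auto
    have "\<bar>(f - l *\<^sub>R z) x\<bar> \<le> norm x" if x: "\<forall>z'\<in>Z. z' x = 0" for x
    proof (cases "z x = 0")
      case True
      then show ?thesis using insert.prems x by (auto simp: blinfun.diff_left blinfun.scaleR_left)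
    next
      case nz: False
      define w where "w = (1 / z x) *\<^sub>R x"
      have w: "w \<in> W" using x nz by (auto simp: W_def w_def blinfun.scaleR_right)
      have "\<bar>f w - l\<bar> \<le> norm w" using lower[OF w] upper[OF w] by auto
      then have "\<bar>z x\<bar> * \<bar>f w - l\<bar> \<le> \<bar>z x\<bar> * norm w" by (simp add: mult_left_mono)
      moreover have "\<bar>z x\<bar> * norm w = norm x" using nz by (simp add: w_def)
      moreover have "\<bar>z x\<bar> * \<bar>f w - l\<bar> = \<bar>(f - l *\<^sub>R z) x\<bar>"
        using nz by (simp add: w_def blinfun.diff_left blinfun.scaleR_left blinfun.scaleR_right
            right_diff_distrib mult.commute[of l] flip: abs_mult)
      ultimately show ?thesis by simp
    qed
    then show ?thesis by blast
  qed
  then obtain l where l: "\<And>x. (\<forall>z'\<in>Z. z' x = 0) \<Longrightarrow> \<bar>(f - l *\<^sub>R z) x\<bar> \<le> norm x" by blast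
  from insert.IH[OF l] obtain g where g: "g \<in> span Z" "norm (f - l *\<^sub>R z - g) \<le> 1" by blast
  have "l *\<^sub>R z + g \<in> span (insert z Z)"
    using g(1) by (meson insertI1 span_add span_base span_mono span_scale subsetD subset_insertI)
  moreover have "norm (f - (l *\<^sub>R z + g)) \<le> 1" using g(2) by (simp add: diff_diff_eq)
  ultimately show ?case by blast
qed

text \<open>Contrapositive of the preceding lemma: some \<open>y\<close> in the annihilator has
  \<open>\<bar>f y\<bar> > norm y\<close>, and dividing by \<open>f y\<close> keeps it in the unit
  ball.\<close>

lemma annihilator_witness:
  fixes f :: "'a::real_normed_vector \<Rightarrow>\<^sub>L real" and Z :: "('a \<Rightarrow>\<^sub>L real) set"
  assumes "finite Z" and far: "\<And>z. z \<in> span Z \<Longrightarrow> norm (f - z) > 1"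
  obtains x where "norm x \<le> 1" "f x = 1" "\<And>z. z \<in> Z \<Longrightarrow> z x = 0"
proof -
  obtain y where y: "\<forall>z\<in>Z. z y = 0" "\<bar>f y\<bar> > norm y"
    using annihilator_extension[OF \<open>finite Z\<close>, of f] far by (meson not_le)
  then have fy: "f y \<noteq> 0" by auto
  show ?thesis
  proof (rule that[of "(1 / f y) *\<^sub>R y"])
    show "norm ((1 / f y) *\<^sub>R y) \<le> 1" using y(2) fy by (simp add: divide_simps)
  qed (use y fy in \<open>auto simp: blinfun.scaleR_right\<close>)
qed

section \<open>Fat sets of functionals\<close>

text \<open>Countability of \<open>C\<close> makes the non-fat sets a sigma-ideal, taking the span
  makes fatness insensitive to adding multiples of a fixed vector, and the threshold 1 is the one
  that \<open>annihilator_witness\<close> asks for.\<close>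

definition fat :: "'b::real_normed_vector set \<Rightarrow> bool" where
  "fat S \<longleftrightarrow> (\<forall>C. countable C \<longrightarrow> (\<exists>f\<in>S. \<forall>z\<in>span C. norm (f - z) > 1))"

lemma fat_mono: "fat S \<Longrightarrow> S \<subseteq> S' \<Longrightarrow> fat S'"
  unfolding fat_def by (meson subsetD)

text \<open>The countable sets witnessing non-fatness of the members have a countable union, whose
  span contains each of their spans.\<close>

lemma not_fat_Union:
  assumes "countable \<S>" and "\<And>S. S \<in> \<S> \<Longrightarrow> \<not> fat S"
  shows "\<not> fat (\<Union>\<S>)"
proof -
  have "\<forall>S\<in>\<S>. \<exists>C. countable C \<and> (\<forall>f\<in>S. \<exists>z\<in>span C. norm (f - z) \<le> 1)"
    using assms(2) unfolding fat_def by (meson not_less)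
  then obtain C where C: "\<And>S. S \<in> \<S> \<Longrightarrow> countable (C S)"
      "\<And>S f. S \<in> \<S> \<Longrightarrow> f \<in> S \<Longrightarrow> \<exists>z\<in>span (C S). norm (f - z) \<le> 1"
    by metis
  have "countable (\<Union>(C ` \<S>))" using assms(1) C(1) by auto
  moreover have "\<exists>z\<in>span (\<Union>(C ` \<S>)). norm (f - z) \<le> 1" if "f \<in> \<Union>\<S>" for f
    using that C(2) by (meson UN_upper UnionE span_mono subsetD)
  ultimately show ?thesis unfolding fat_def by (meson not_le)
qed

lemma fat_Un:
  assumes "fat (S \<union> S')" shows "fat S \<or> fat S'"
  using not_fat_Union[of "{S, S'}"] assms by auto

text \<open>Testing the shifted set against \<open>C\<close> amounts to testing \<open>S\<close>
  against \<open>insert g C\<close>, whose span absorbs the correction whatever the coefficients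
  \<open>\<phi> h\<close> are.\<close>

lemma fat_shift:
  fixes g :: "'b::real_normed_vector"
  assumes "fat S" shows "fat ((\<lambda>h. h - \<phi> h *\<^sub>R g) ` S)"
  unfolding fat_def
proof (intro allI impI)
  fix C :: "'b set" assume "countable C"
  then have "countable (insert g C)" by simp
  then obtain f where f: "f \<in> S" "\<forall>z\<in>span (insert g C). norm (f - z) > 1"
    using assms unfolding fat_def by blast
  have "norm (f - \<phi> f *\<^sub>R g - z) > 1" if "z \<in> span C" for z
  proof -
    have "\<phi> f *\<^sub>R g + z \<in> span (insert g C)"
      using that by (meson insertI1 span_add span_base span_mono span_scale subsetD subset_insertI)
    then show ?thesis using f(2) by (metis diff_diff_eq)
  qed
  then show "\<exists>f\<in>(\<lambda>h. h - \<phi> h *\<^sub>R g) ` S. \<forall>z\<in>span C. norm (f - z) > 1" using f(1) by blast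
qed

text \<open>Rational combinations are coded as lists of pairs, so that appending lists gives closure
  under addition.\<close>

lemma countable_dense_in_span:
  fixes C :: "'b::real_normed_vector set"
  assumes "countable C"
  obtains Q where "countable Q" "span C \<subseteq> closure Q"
proof -
  define v :: "(rat \<times> 'b) list \<Rightarrow> 'b" where "v l = (\<Sum>(q, c)\<leftarrow>l. of_rat q *\<^sub>R c)" for l
  define Q where "Q = v ` lists (UNIV \<times> C)"
  have v_app: "v (l @ l') = v l + v l'" for l l' by (simp add: v_def)
  have Q_add: "a + b \<in> Q" if "a \<in> Q" "b \<in> Q" for a b
  proof -
    obtain l l' where "l \<in> lists (UNIV \<times> C)" "l' \<in> lists (UNIV \<times> C)" "a = v l" "b = v l'"
      using \<open>a \<in> Q\<close> \<open>b \<in> Q\<close> unfolding Q_def by blast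
    then show ?thesis unfolding Q_def
      by (intro image_eqI[of _ _ "l @ l'"]) (auto simp: v_app)
  qed
  have "countable Q" unfolding Q_def using assms by (intro countable_image countable_lists) auto
  moreover have "span C \<subseteq> closure Q"
  proof
    fix x assume "x \<in> span C"
    then show "x \<in> closure Q"
    proof (induction rule: span_induct_alt)
      case base
      have "v [] \<in> Q" unfolding Q_def by (intro imageI) simp
      then show ?case using closure_subset by (auto simp: v_def)
    next
      case (step r c y)
      show ?case unfolding closure_approachable
      proof (intro allI impI)
        fix e :: real assume e: "e > 0"
        obtain b where b: "b \<in> Q" "dist b y < e / 2"
          using step(2) e unfolding closure_approachable by (meson half_gt_zero)
        \<comment> \<open>Half of the error is spent on \<open>b\<close> and half on the rational
          coefficient; the summand 1 covers the case \<open>c = 0\<close>.\<close>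
        have "e / (2 * (norm c + 1)) > 0" using e by (simp add: add_nonneg_pos)
        then obtain q where q: "r < of_rat q" "of_rat q < r + e / (2 * (norm c + 1))"
          using of_rat_dense[of r "r + e / (2 * (norm c + 1))"] by auto
        have "[(q, c)] \<in> lists (UNIV \<times> C)" using step(1) by simp
        then have "v [(q, c)] \<in> Q" unfolding Q_def by blast
        then have qc: "of_rat q *\<^sub>R c \<in> Q" by (simp add: v_def)
        have "dist (of_rat q *\<^sub>R c + b) (r *\<^sub>R c + y)
            \<le> norm ((of_rat q - r) *\<^sub>R c) + dist b y"
          unfolding dist_norm scaleR_diff_left add_diff_add by (rule norm_triangle_ineq)
        also have "norm ((of_rat q - r) *\<^sub>R c) \<le> e / (2 * (norm c + 1)) * (norm c + 1)"
          unfolding norm_scaleR using q by (intro mult_mono) auto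
        also have "\<dots> = e / 2"
          using norm_ge_zero[of c] by (simp add: field_simps del: norm_ge_zero)
        finally have "dist (of_rat q *\<^sub>R c + b) (r *\<^sub>R c + y) < e" using b(2) by simp
        then show "\<exists>z\<in>Q. dist z (r *\<^sub>R c + y) < e" using Q_add[OF qc b(1)] by blast
      qed
    qed
  qed
  ultimately show ?thesis by (rule that)
qed

text \<open>If \<open>C\<close> witnesses non-fatness, scaling shows that every \<open>f\<close> has
  distance at most \<open>norm f / r\<close> from \<open>span C\<close>. Applying this to
  \<open>f - y\<close> with \<open>y\<close> in the span and taking the infimum over
  \<open>y\<close> bounds the distance of \<open>f\<close> by \<open>1 / r\<close> times itself. As
  \<open>r > 1\<close> it is 0, so \<open>span C\<close> is dense and the space separable.\<close>

lemma fat_cball: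
  assumes nonsep: "\<not> separable_space (euclidean :: 'b::real_normed_vector topology)" and "r > 1"
  shows "fat (cball (0::'b) r)"
proof (rule ccontr)
  assume "\<not> fat (cball (0::'b) r)"
  then obtain C :: "'b set" where C: "countable C"
      "\<And>f. norm f \<le> r \<Longrightarrow> \<exists>z\<in>span C. norm (f - z) \<le> 1"
    unfolding fat_def by (auto simp: not_less)
  have contract: "infdist f (span C) \<le> norm f / r" for f
  proof (cases "f = 0")
    case True
    then show ?thesis by (simp add: infdist_zero span_zero)
  next
    case False
    define a where "a = r / norm f"
    have a: "a > 0" using False \<open>r > 1\<close> by (simp add: a_def)
    have "norm (a *\<^sub>R f) \<le> r" using False \<open>r > 1\<close> by (simp add: a_def)
    then obtain z where z: "z \<in> span C" "norm (a *\<^sub>R f - z) \<le> 1" using C(2) by blast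
    have "f - (1 / a) *\<^sub>R z = (1 / a) *\<^sub>R (a *\<^sub>R f - z)" using a by (simp add: scaleR_diff_right)
    then have "dist f ((1 / a) *\<^sub>R z) \<le> 1 / a"
      using z(2) a by (simp add: dist_norm divide_right_mono)
    moreover have "(1 / a) *\<^sub>R z \<in> span C" using z(1) by (rule span_scale)
    ultimately have "infdist f (span C) \<le> 1 / a" by (metis infdist_le2)
    then show ?thesis by (simp add: a_def)
  qed
  have nz: "span C \<noteq> {}" using span_zero by blast
  have "infdist f (span C) = 0" for f
  proof -
    let ?d = "infdist f (span C)"
    have "r * ?d \<le> dist f y" if y: "y \<in> span C" for y
    proof -
      have "?d \<le> infdist (f - y) (span C)"
      proof -
        have "?d \<le> dist (f - y) w" if "w \<in> span C" for w
          using infdist_le[OF span_add[OF y that], of f] by (simp add: dist_norm diff_diff_eq)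
        then show ?thesis using nz by (subst (2) infdist_notempty) (auto intro!: cINF_greatest)
      qed
      also have "\<dots> \<le> norm (f - y) / r" by (rule contract)
      finally show ?thesis using \<open>r > 1\<close> by (simp add: dist_norm field_simps)
    qed
    then have "r * ?d \<le> ?d"
      using nz by (subst (2) infdist_notempty) (auto intro!: cINF_greatest)
    then have "(r - 1) * ?d \<le> 0" by (simp add: algebra_simps)
    then show ?thesis using \<open>r > 1\<close> infdist_nonneg[of f "span C"]
      by (simp add: mult_le_0_iff)
  qed
  then have cl: "closure (span C) = UNIV" using in_closure_iff_infdist_zero[OF nz] by auto
  obtain Q where Q: "countable Q" "span C \<subseteq> closure Q"
    using countable_dense_in_span[OF C(1)] by blast
  have "closure Q = UNIV" using cl closure_minimal[OF Q(2)] by auto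
  then have "separable_space (euclidean :: 'b topology)"
    using Q(1) unfolding separable_space_def by auto
  then show False using nonsep by contradiction
qed

text \<open>The open sets \<open>U\<close> live in the function type with its product topology, the
  topology of pointwise convergence, so their traces on \<open>P\<close> are exactly the relatively
  weak* open subsets of \<open>P\<close>.\<close>

definition hereditarily_fat :: "('a::real_normed_vector \<Rightarrow>\<^sub>L real) set \<Rightarrow> bool" where
  "hereditarily_fat P \<longleftrightarrow> P \<noteq> {} \<and>
    (\<forall>U. open U \<longrightarrow> (\<exists>f\<in>P. blinfun_apply f \<in> U) \<longrightarrow> fat {f\<in>P. blinfun_apply f \<in> U})"

lemma hereditarily_fat_nonempty: "hereditarily_fat P \<Longrightarrow> P \<noteq> {}"
  by (simp add: hereditarily_fat_def)

lemma hereditarily_fatD: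
  "hereditarily_fat P \<Longrightarrow> open U \<Longrightarrow> f \<in> P \<Longrightarrow> blinfun_apply f \<in> U \<Longrightarrow>
    fat {f\<in>P. blinfun_apply f \<in> U}"
  unfolding hereditarily_fat_def by blast

lemma hereditarily_fat_imp_fat: "hereditarily_fat P \<Longrightarrow> fat P"
  using hereditarily_fatD[of P UNIV] hereditarily_fat_nonempty[of P] by auto

lemma hereditarily_fat_open_Int:
  assumes "hereditarily_fat P" "open V" "f \<in> P" "blinfun_apply f \<in> V"
  shows "hereditarily_fat {f\<in>P. blinfun_apply f \<in> V}"
  unfolding hereditarily_fat_def
proof (intro conjI allI impI)
  show "{f\<in>P. blinfun_apply f \<in> V} \<noteq> {}" using assms by auto
  fix U assume U: "open U" "\<exists>f\<in>{f\<in>P. blinfun_apply f \<in> V}. blinfun_apply f \<in> U"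
  then obtain f where "f \<in> P" "blinfun_apply f \<in> V \<inter> U" by blast
  then have "fat {f\<in>P. blinfun_apply f \<in> V \<inter> U}"
    using assms(1,2) U(1) by (intro hereditarily_fatD[of P]) auto
  then show "fat {f \<in> {f \<in> P. blinfun_apply f \<in> V}. blinfun_apply f \<in> U}"
    by (rule fat_mono) auto
qed

text \<open>The shift is continuous for pointwise convergence, so weak* open sets pull back to weak*
  open sets and \<open>fat_shift\<close> applies to their traces. When \<open>g x = 1\<close>, it
  moves every functional to one with value exactly \<open>c\<close> at \<open>x\<close>.\<close>

lemma hereditarily_fat_shift:
  fixes P :: "('a::real_normed_vector \<Rightarrow>\<^sub>L real) set" and g :: "'a \<Rightarrow>\<^sub>L real"
  assumes "hereditarily_fat P"
  shows "hereditarily_fat ((\<lambda>h. h - (blinfun_apply h x - c) *\<^sub>R g) ` P)"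
  unfolding hereditarily_fat_def
proof (intro conjI allI impI)
  show "(\<lambda>h. h - (blinfun_apply h x - c) *\<^sub>R g) ` P \<noteq> {}" using assms hereditarily_fat_nonempty by auto
  fix U :: "('a \<Rightarrow> real) set"
  assume U: "open U" "\<exists>f\<in>(\<lambda>h. h - (blinfun_apply h x - c) *\<^sub>R g) ` P. blinfun_apply f \<in> U"
  define \<tau> where "\<tau> u = (\<lambda>y. u y - (u x - c) * g y)" for u :: "'a \<Rightarrow> real"
  have app: "blinfun_apply (h - (blinfun_apply h x - c) *\<^sub>R g) = \<tau> (blinfun_apply h)" for h
    by (auto simp: \<tau>_def blinfun.diff_left blinfun.scaleR_left)
  have "continuous_on UNIV \<tau>" unfolding \<tau>_def
    by (intro continuous_on_coordinatewise_then_product continuous_intros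
        continuous_on_product_coordinates)
  then have "open (\<tau> -` U)" using U(1) by (simp add: open_vimage)
  moreover obtain h where "h \<in> P" "blinfun_apply h \<in> \<tau> -` U" using U(2) app by auto
  ultimately have "fat {h\<in>P. blinfun_apply h \<in> \<tau> -` U}"
    by (rule hereditarily_fatD[OF assms])
  then have "fat ((\<lambda>h. h - (blinfun_apply h x - c) *\<^sub>R g) ` {h\<in>P. blinfun_apply h \<in> \<tau> -` U})"
    by (rule fat_shift)
  then show "fat {f \<in> (\<lambda>h. h - (blinfun_apply h x - c) *\<^sub>R g) ` P. blinfun_apply f \<in> U}"
    by (rule fat_mono) (auto simp: app)
qed

text \<open>Functionals of norm at most \<open>M\<close> are equicontinuous, so their values at
  finitely many \<open>d i\<close> control those at finitely many arbitrary points. This replaces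
  \<open>U\<close> by an open set of the second countable space
  \<open>nat \<Rightarrow> real\<close>.\<close>

lemma bounded_functionals_dense_neighbourhood:
  fixes d :: "nat \<Rightarrow> 'a::real_normed_vector" and f :: "'a \<Rightarrow>\<^sub>L real"
  assumes dense: "closure (range d) = UNIV" and "open U" "blinfun_apply f \<in> U" "norm f \<le> M"
  obtains V :: "(nat \<Rightarrow> real) set" where "open V" "(\<lambda>i. f (d i)) \<in> V"
    "\<And>h. norm h \<le> M \<Longrightarrow> (\<lambda>i. blinfun_apply h (d i)) \<in> V \<Longrightarrow> blinfun_apply h \<in> U"
proof -
  have "openin (product_topology (\<lambda>i. euclidean) UNIV) U"
    using \<open>open U\<close> by (simp add: open_fun_def)
  from product_topology_open_contains_basis[OF this \<open>blinfun_apply f \<in> U\<close>]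
  obtain X where X: "blinfun_apply f \<in> (\<Pi>\<^sub>E i\<in>UNIV. X i)" "\<And>i. open (X i)"
      "finite {i. X i \<noteq> UNIV}" "(\<Pi>\<^sub>E i\<in>UNIV. X i) \<subseteq> U"
    by auto
  define F where "F = {i. X i \<noteq> UNIV}"
  have "\<exists>V :: (nat \<Rightarrow> real) set. open V \<and> (\<lambda>i. f (d i)) \<in> V \<and>
      (\<forall>h. norm h \<le> M \<longrightarrow> (\<lambda>i. blinfun_apply h (d i)) \<in> V \<longrightarrow> blinfun_apply h x \<in> X x)" for x
  proof -
    have "f x \<in> X x" using X(1) by auto
    then obtain e where e: "e > 0" "ball (f x) e \<subseteq> X x" using X(2) openE by blast
    have M: "M \<ge> 0" using \<open>norm f \<le> M\<close> norm_ge_zero order_trans by blast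
    \<comment> \<open>A three-term estimate: moving from \<open>x\<close> to \<open>d i\<close>
      costs less than \<open>e / 3\<close> for each of \<open>f\<close> and \<open>h\<close>, and
      \<open>V\<close> allows a further \<open>e / 3\<close> at \<open>d i\<close>.\<close>
    have "e / (3 * (M + 1)) > 0" using e M by simp
    then obtain i where i: "dist (d i) x < e / (3 * (M + 1))"
      using dense by (metis UNIV_I closure_approachable rangeE)
    have near: "\<bar>h (d i) - h x\<bar> < e / 3" if "norm h \<le> M" for h :: "'a \<Rightarrow>\<^sub>L real"
    proof -
      have "\<bar>h (d i) - h x\<bar> \<le> norm h * norm (d i - x)"
        using norm_blinfun[of h "d i - x"] by (simp add: blinfun.diff_right)
      also have "\<dots> \<le> (M + 1) * norm (d i - x)" using that by (intro mult_right_mono) auto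
      also have "\<dots> < (M + 1) * (e / (3 * (M + 1)))"
        using i M by (intro mult_strict_left_mono) (auto simp: dist_norm)
      also have "\<dots> = e / 3" using M by (simp add: field_simps)
      finally show ?thesis .
    qed
    define V where "V = {u :: nat \<Rightarrow> real. \<bar>u i - f (d i)\<bar> < e / 3}"
    have "open V" unfolding V_def
      by (intro open_Collect_less continuous_intros continuous_on_product_coordinates)
    moreover have "blinfun_apply h x \<in> X x" if "norm h \<le> M" "(\<lambda>i. blinfun_apply h (d i)) \<in> V" for h
    proof -
      have "\<bar>h (d i) - f (d i)\<bar> < e / 3" using that(2) by (simp add: V_def)
      then have "dist (f x) (h x) < e"
        using near[OF that(1)] near[OF \<open>norm f \<le> M\<close>] unfolding dist_real_def by linarith
      then show ?thesis using e(2) by auto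
    qed
    ultimately show ?thesis using e(1) by (intro exI[of _ V]) (auto simp: V_def)
  qed
  then obtain V where V: "\<And>x. open (V x :: (nat \<Rightarrow> real) set)" "\<And>x. (\<lambda>i. f (d i)) \<in> V x"
      "\<And>x h. norm h \<le> M \<Longrightarrow> (\<lambda>i. blinfun_apply h (d i)) \<in> V x \<Longrightarrow> blinfun_apply h x \<in> X x"
    by metis
  show ?thesis
  proof (rule that[of "\<Inter>x\<in>F. V x"])
    show "open (\<Inter>x\<in>F. V x)" using X(3) V(1) by (auto simp: F_def)
    fix h :: "'a \<Rightarrow>\<^sub>L real" assume "norm h \<le> M" "(\<lambda>i. h (d i)) \<in> (\<Inter>x\<in>F. V x)"
    then have "h x \<in> X x" for x using V(3)[of h x] by (cases "x \<in> F") (auto simp: F_def)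
    then show "blinfun_apply h \<in> U" using X(4) by auto
  qed (use V(2) in auto)
qed

text \<open>A Cantor-Bendixson argument: discard all traces of open sets of
  \<open>nat \<Rightarrow> real\<close> that are not fat. By Lindelof countably many of them make up
  the discarded set \<open>B\<close>, so \<open>B\<close> is not fat.\<close>

lemma fat_imp_hereditarily_fat_subset:
  fixes S :: "('a::real_normed_vector \<Rightarrow>\<^sub>L real) set" and d :: "nat \<Rightarrow> 'a"
  assumes dense: "closure (range d) = UNIV"
    and "fat S" and bd: "\<And>f. f \<in> S \<Longrightarrow> norm f \<le> M"
  obtains P where "P \<subseteq> S" "hereditarily_fat P"
proof -
  define \<phi> where "\<phi> h = (\<lambda>i. h (d i))" for h :: "'a \<Rightarrow>\<^sub>L real"
  define \<O> where "\<O> = {V. open V \<and> \<not> fat {h\<in>S. \<phi> h \<in> V}}"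
  obtain \<O>' where \<O>': "\<O>' \<subseteq> \<O>" "countable \<O>'" "\<Union>\<O>' = \<Union>\<O>"
    using Lindelof[of \<O>] by (auto simp: \<O>_def)
  define B where "B = {h\<in>S. \<phi> h \<in> \<Union>\<O>}"
  have "\<not> fat (\<Union>V\<in>\<O>'. {h\<in>S. \<phi> h \<in> V})"
    using \<O>' by (intro not_fat_Union) (auto simp: \<O>_def)
  moreover have "(\<Union>V\<in>\<O>'. {h\<in>S. \<phi> h \<in> V}) = B" unfolding B_def \<O>'(3)[symmetric] by auto
  ultimately have B: "\<not> fat B" by simp
  have "hereditarily_fat (S - B)"
    unfolding hereditarily_fat_def
  proof (intro conjI allI impI)
    show "S - B \<noteq> {}" using \<open>fat S\<close> B fat_mono by blast
    fix U :: "('a \<Rightarrow> real) set"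
    assume U: "open U" "\<exists>f\<in>S - B. blinfun_apply f \<in> U"
    then obtain f where f: "f \<in> S" "f \<notin> B" "blinfun_apply f \<in> U" by auto
    obtain V where V: "open V" "\<phi> f \<in> V"
        "\<And>h. norm h \<le> M \<Longrightarrow> \<phi> h \<in> V \<Longrightarrow> blinfun_apply h \<in> U"
      unfolding \<phi>_def
      using bounded_functionals_dense_neighbourhood[OF dense U(1) f(3) bd[OF f(1)]] by metis
    \<comment> \<open>Since \<open>f\<close> was not discarded, \<open>V\<close> is not in
      \<open>\<O>\<close>. Its trace on \<open>S\<close> is therefore fat, and remains so after
      removing the non-fat \<open>B\<close>.\<close>
    have "fat {h\<in>S. \<phi> h \<in> V}" using f V by (auto simp: B_def \<O>_def)
    then have "fat ({h\<in>S - B. blinfun_apply h \<in> U} \<union> B)"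
      by (rule fat_mono) (use V(3) bd in auto)
    then show "fat {h\<in>S - B. blinfun_apply h \<in> U}" using fat_Un B by blast
  qed
  then show ?thesis using that[of "S - B"] by auto
qed

section \<open>The tree of functionals\<close>

text \<open>These are the settled vectors, whose values must survive all later perturbations of the
  functionals.\<close>

definition agreement :: "'i set \<Rightarrow> ('i \<Rightarrow> ('a::real_normed_vector \<Rightarrow>\<^sub>L real) set) \<Rightarrow> 'a set" where
  "agreement I P = {y. \<forall>i\<in>I. \<forall>f\<in>P i. \<forall>h\<in>P i. f y = h y}"

lemma agreementD:
  "y \<in> agreement I P \<Longrightarrow> i \<in> I \<Longrightarrow> f \<in> P i \<Longrightarrow> h \<in> P i \<Longrightarrow> blinfun_apply f y = h y"
  unfolding agreement_def by blast

text \<open>Fatness of \<open>P j\<close> is tested against the finitely many chosen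
  \<open>k i\<close>, which is what \<open>annihilator_witness\<close> can handle. The slices
  \<open>R i\<close> of functionals with value near \<open>c i\<close> at \<open>x\<close> remain
  hereditarily fat, and moving them along \<open>g\<close> makes these values exact at a norm cost
  of at most \<open>\<delta>\<close>.\<close>

lemma isolate_one:
  fixes P :: "'i \<Rightarrow> ('a::real_normed_vector \<Rightarrow>\<^sub>L real) set"
  assumes "finite I" "j \<in> I" and P: "\<forall>i\<in>I. hereditarily_fat (P i)" and "\<delta> > 0"
  shows "\<exists>P' x. norm x \<le> 1 \<and> (\<forall>i\<in>I. hereditarily_fat (P' i) \<and>
    (\<forall>f\<in>P' i. blinfun_apply f x = of_bool (i = j) \<and>
      (\<exists>h\<in>P i. norm (f - h) \<le> \<delta> \<and> (\<forall>y\<in>agreement I P. blinfun_apply f y = h y))))"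
proof -
  have "\<forall>i\<in>I. \<exists>f. f \<in> P i" using P hereditarily_fat_nonempty by blast
  then obtain k where k: "\<And>i. i \<in> I \<Longrightarrow> k i \<in> P i" by metis
  have "fat (P j)" using P \<open>j \<in> I\<close> hereditarily_fat_imp_fat by blast
  then obtain m where m: "m \<in> P j" "\<And>z. z \<in> span (k ` I) \<Longrightarrow> norm (m - z) > 1"
    using \<open>finite I\<close> unfolding fat_def by (meson countable_finite finite_imageI)
  obtain x where x: "norm x \<le> 1" "m x = 1" "\<And>z. z \<in> k ` I \<Longrightarrow> blinfun_apply z x = 0"
    using annihilator_witness[OF finite_imageI[OF \<open>finite I\<close>] m(2)] by blast
  have kx: "k i x = 0" if "i \<in> I" for i using x(3) that by blast
  \<comment> \<open>Both functionals lie in P j, so adding multiples of g changes no value on the agreement set.\<close>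
  define g where "g = m - k j"
  have gx: "g x = 1" using x kx \<open>j \<in> I\<close> by (simp add: g_def blinfun.diff_left)
  have g0: "g y = 0" if "y \<in> agreement I P" for y
    using agreementD[OF that \<open>j \<in> I\<close> m(1) k[OF \<open>j \<in> I\<close>]] by (simp add: g_def blinfun.diff_left)
  \<comment> \<open>Chosen so that a correction by less than \<open>\<eta>\<close> times
    \<open>g\<close> has norm at most \<open>\<delta>\<close>; the summand 1 keeps the denominator
    positive.\<close>
  define \<eta> where "\<eta> = \<delta> / (norm g + 1)"
  have \<eta>: "\<eta> > 0" using \<open>\<delta> > 0\<close> by (simp add: \<eta>_def add_nonneg_pos)
  define c :: "'i \<Rightarrow> real" where "c i = of_bool (i = j)" for i
  define T where "T i h = h - (h x - c i) *\<^sub>R g" for i and h :: "'a \<Rightarrow>\<^sub>L real"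
  define R where "R i = {h\<in>P i. blinfun_apply h \<in> {u. \<bar>u x - c i\<bar> < \<eta>}}" for i
  have R: "hereditarily_fat (R i)" if i: "i \<in> I" for i
  proof -
    have "open {u :: 'a \<Rightarrow> real. \<bar>u x - c i\<bar> < \<eta>}"
      by (intro open_Collect_less continuous_intros continuous_on_product_coordinates)
    \<comment> \<open>The slice is non-empty: it contains \<open>m\<close> for \<open>i = j\<close>,
      and \<open>k i\<close> otherwise.\<close>
    moreover obtain h where "h \<in> P i" "blinfun_apply h x = c i"
      using k[OF i] m(1) x(2) kx[OF i] by (cases "i = j") (auto simp: c_def)
    ultimately show ?thesis unfolding R_def
      using \<eta> by (intro hereditarily_fat_open_Int[OF P[rule_format, OF i]]) auto
  qed
  show ?thesis
  proof (intro exI[of _ "\<lambda>i. T i ` R i"] exI[of _ x] conjI ballI)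
    show "hereditarily_fat (T i ` R i)" if "i \<in> I" for i
      unfolding T_def by (rule hereditarily_fat_shift[OF R[OF that]])
    fix i f assume "i \<in> I" "f \<in> T i ` R i"
    then obtain h where h: "h \<in> P i" "\<bar>h x - c i\<bar> < \<eta>" "f = h - (h x - c i) *\<^sub>R g"
      by (auto simp: R_def T_def)
    show "f x = of_bool (i = j)"
      using gx by (simp add: h(3) c_def blinfun.diff_left blinfun.scaleR_left)
    have "norm (f - h) = \<bar>h x - c i\<bar> * norm g" by (simp add: h(3))
    also have "\<dots> \<le> \<eta> * (norm g + 1)" using h(2) \<eta> by (intro mult_mono) auto
    also have "\<dots> = \<delta>" by (simp add: \<eta>_def add_nonneg_eq_0_iff)
    finally show "\<exists>h\<in>P i. norm (f - h) \<le> \<delta> \<and> (\<forall>y\<in>agreement I P. blinfun_apply f y = h y)"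
      using h(1) g0 by (intro bexI[of _ h]) (auto simp: h(3) blinfun.diff_left blinfun.scaleR_left)
  qed (use x in auto)
qed

text \<open>Induction on \<open>J\<close>: half of the tolerance goes to the earlier indices and
  half to the last application of \<open>isolate_one\<close>. That application leaves the earlier
  vectors exact because they belong to the agreement set by then.\<close>

lemma isolate_all:
  fixes P :: "'i \<Rightarrow> ('a::real_normed_vector \<Rightarrow>\<^sub>L real) set"
  assumes "finite I" and P: "\<forall>i\<in>I. hereditarily_fat (P i)" and "\<delta> > 0" and "J \<subseteq> I"
  shows "\<exists>P'. (\<forall>i\<in>I. hereditarily_fat (P' i)) \<and>
    (\<forall>j\<in>J. \<exists>x. norm x \<le> 1 \<and> (\<forall>i\<in>I. \<forall>f\<in>P' i. blinfun_apply f x = of_bool (i = j))) \<and>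
    (\<forall>i\<in>I. \<forall>f\<in>P' i. \<exists>h\<in>P i. norm (f - h) \<le> \<delta> \<and>
      (\<forall>y\<in>agreement I P. blinfun_apply f y = h y))"
proof -
  have "finite J" using \<open>J \<subseteq> I\<close> \<open>finite I\<close> finite_subset by blast
  then show ?thesis using \<open>J \<subseteq> I\<close> \<open>\<delta> > 0\<close>
  proof (induction J arbitrary: \<delta> rule: finite_induct)
    case empty
    have "\<exists>h\<in>P i. norm (f - h) \<le> \<delta> \<and> (\<forall>y\<in>agreement I P. blinfun_apply f y = h y)"
      if "f \<in> P i" for f i using that empty by (intro bexI[of _ f]) auto
    then show ?case using P by (intro exI[of _ P]) auto
  next
    case (insert j J)
    then have "\<delta> / 2 > 0" "J \<subseteq> I" "j \<in> I" by auto
    from insert.IH[OF this(2,1)] obtain Q where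
      Q: "\<forall>i\<in>I. hereditarily_fat (Q i)"
        "\<And>j. j \<in> J \<Longrightarrow> \<exists>x. norm x \<le> 1 \<and> (\<forall>i\<in>I. \<forall>f\<in>Q i. blinfun_apply f x = of_bool (i = j))"
        "\<And>i f. i \<in> I \<Longrightarrow> f \<in> Q i \<Longrightarrow> \<exists>h\<in>P i. norm (f - h) \<le> \<delta> / 2 \<and>
          (\<forall>y\<in>agreement I P. blinfun_apply f y = h y)"
      by blast
    \<comment> \<open>Values at settled vectors are inherited from \<open>P i\<close>, so settled
      vectors stay settled.\<close>
    have sub: "agreement I P \<subseteq> agreement I Q"
    proof
      fix y assume y: "y \<in> agreement I P"
      have "f y = f' y" if i: "i \<in> I" "f \<in> Q i" "f' \<in> Q i" for i f f'
      proof -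
        obtain h h' where "h \<in> P i" "h' \<in> P i" "f y = h y" "f' y = h' y"
          using Q(3)[OF i(1,2)] Q(3)[OF i(1,3)] y by metis
        then show ?thesis using agreementD[OF y i(1)] by metis
      qed
      then show "y \<in> agreement I Q" unfolding agreement_def by blast
    qed
    obtain P' x where x: "norm x \<le> 1" and P'_all: "\<forall>i\<in>I. hereditarily_fat (P' i) \<and>
        (\<forall>f\<in>P' i. blinfun_apply f x = of_bool (i = j) \<and>
          (\<exists>h\<in>Q i. norm (f - h) \<le> \<delta> / 2 \<and> (\<forall>y\<in>agreement I Q. blinfun_apply f y = h y)))"
      using isolate_one[of I j Q "\<delta> / 2", OF \<open>finite I\<close> \<open>j \<in> I\<close> Q(1) \<open>\<delta> / 2 > 0\<close>] by (elim exE conjE)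
    have P': "hereditarily_fat (P' i)"
        "f \<in> P' i \<Longrightarrow> blinfun_apply f x = of_bool (i = j)"
        "f \<in> P' i \<Longrightarrow>
          \<exists>h\<in>Q i. norm (f - h) \<le> \<delta> / 2 \<and> (\<forall>y\<in>agreement I Q. blinfun_apply f y = h y)"
      if "i \<in> I" for i f
      using P'_all that by blast+
    have "\<exists>x. norm x \<le> 1 \<and> (\<forall>i\<in>I. \<forall>f\<in>P' i. blinfun_apply f x = of_bool (i = j'))"
      if j': "j' \<in> insert j J" for j'
    proof (cases "j' = j")
      case True
      then show ?thesis using x P'(2) by blast
    next
      case False
      then obtain y where y: "norm y \<le> 1"
          "\<And>i f. i \<in> I \<Longrightarrow> f \<in> Q i \<Longrightarrow> blinfun_apply f y = of_bool (i = j')"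
        using j' Q(2)[of j'] by auto
      then have "y \<in> agreement I Q" by (auto simp: agreement_def)
      then have "blinfun_apply f y = of_bool (i = j')" if "i \<in> I" "f \<in> P' i" for i f
        using P'(3)[OF that] y(2) that(1) by metis
      then show ?thesis using y(1) by blast
    qed
    moreover have "\<exists>h\<in>P i. norm (f - h) \<le> \<delta> \<and> (\<forall>y\<in>agreement I P. blinfun_apply f y = h y)"
      if i: "i \<in> I" "f \<in> P' i" for i f
    proof -
      obtain h where h: "h \<in> Q i" "norm (f - h) \<le> \<delta> / 2"
          "\<And>y. y \<in> agreement I Q \<Longrightarrow> f y = h y"
        using P'(3)[OF i] by blast
      obtain h' where h': "h' \<in> P i" "norm (h - h') \<le> \<delta> / 2"
          "\<And>y. y \<in> agreement I P \<Longrightarrow> h y = h' y"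
        using Q(3)[OF i(1) h(1)] by blast
      have "norm (f - h') \<le> \<delta>"
        using norm_triangle_ineq[of "f - h" "h - h'"] h(2) h'(2) by simp
      then show ?thesis using h(3) h'(1,3) sub by (metis subsetD)
    qed
    ultimately show ?case using P'(1) by blast
  qed
qed

text \<open>The norm bound leaves room for the perturbation of size e / 2 ^ (n + 2) made on passing
to the next stage.\<close>

definition stage :: "(nat \<Rightarrow> 'a::real_normed_vector) \<Rightarrow> real \<Rightarrow> nat \<Rightarrow>
    (bool list \<Rightarrow> ('a \<Rightarrow>\<^sub>L real) set) \<Rightarrow> bool" where
  "stage d e n P \<longleftrightarrow>
    (\<forall>t. length t = n \<longrightarrow> hereditarily_fat (P t)) \<and>
    (\<forall>t. length t = n \<longrightarrow> (\<forall>f\<in>P t. norm f \<le> 1 + e - e / 2 ^ Suc n)) \<and>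
    (\<forall>t. length t = n \<longrightarrow> (\<forall>f\<in>P t. \<forall>h\<in>P t. \<forall>i\<le>n. \<bar>f (d i) - h (d i)\<bar> \<le> (1/2) ^ n)) \<and>
    (\<forall>u. length u = n \<longrightarrow> (\<exists>x. norm x \<le> 1 \<and>
      (\<forall>t. length t = n \<longrightarrow> (\<forall>f\<in>P t. blinfun_apply f x = of_bool (t = u)))))"

text \<open>After \<open>isolate_all\<close> the sets are cut down to weak* neighbourhoods in order
  to control the oscillation at \<open>d i\<close>. Cutting comes second because exact values and
  closeness to \<open>P\<close> pass to subsets, and hereditary fatness to non-empty relatively open
  ones.\<close>

lemma stage_from:
  fixes P :: "bool list \<Rightarrow> ('a::real_normed_vector \<Rightarrow>\<^sub>L real) set"
  assumes P: "\<forall>t. length t = n \<longrightarrow> hereditarily_fat (P t)" and "\<delta> > 0"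
    and bd: "\<forall>t. length t = n \<longrightarrow> (\<forall>f\<in>P t. norm f + \<delta> \<le> 1 + e - e / 2 ^ Suc n)"
  shows "\<exists>P'. stage d e n P' \<and> (\<forall>t. length t = n \<longrightarrow> (\<forall>f\<in>P' t. \<exists>h\<in>P t. norm (f - h) \<le> \<delta> \<and>
      (\<forall>y\<in>agreement {t. length t = n} P. blinfun_apply f y = h y)))"
proof -
  define I where "I = {t :: bool list. length t = n}"
  have "finite I" using finite_lists_length_eq[of "UNIV :: bool set" n] by (simp add: I_def)
  have PI: "\<forall>i\<in>I. hereditarily_fat (P i)" using P by (auto simp: I_def)
  obtain Q where Q: "\<And>i. i \<in> I \<Longrightarrow> hereditarily_fat (Q i)"
      "\<And>j. j \<in> I \<Longrightarrow> \<exists>x. norm x \<le> 1 \<and> (\<forall>i\<in>I. \<forall>f\<in>Q i. blinfun_apply f x = of_bool (i = j))"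
      "\<And>i f. i \<in> I \<Longrightarrow> f \<in> Q i \<Longrightarrow> \<exists>h\<in>P i. norm (f - h) \<le> \<delta> \<and>
        (\<forall>y\<in>agreement I P. blinfun_apply f y = h y)"
    using isolate_all[of I P \<delta> I, OF \<open>finite I\<close> PI \<open>\<delta> > 0\<close> order_refl] by blast
  have "\<forall>i\<in>I. \<exists>f. f \<in> Q i" using Q(1) hereditarily_fat_nonempty by blast
  then obtain k where k: "\<And>i. i \<in> I \<Longrightarrow> k i \<in> Q i" by metis
  \<comment> \<open>Radius \<open>(1/2) ^ Suc n\<close> around \<open>k t\<close> gives oscillation
    at most \<open>(1/2) ^ n\<close> between two members.\<close>
  define V where "V t = (\<Inter>i\<le>n. {u. \<bar>u (d i) - k t (d i)\<bar> < (1/2) ^ Suc n})" for t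
  have V: "open (V t)" for t unfolding V_def
    by (intro open_INT ballI open_Collect_less continuous_intros continuous_on_product_coordinates)
      auto
  define P' where "P' t = {h\<in>Q t. blinfun_apply h \<in> V t}" for t
  have P'Q: "P' t \<subseteq> Q t" for t by (auto simp: P'_def)
  have "hereditarily_fat (P' t)" if "t \<in> I" for t
    unfolding P'_def using k[OF that]
    by (intro hereditarily_fat_open_Int[OF Q(1)[OF that] V k[OF that]]) (auto simp: V_def)
  moreover have "norm f \<le> 1 + e - e / 2 ^ Suc n" if t: "t \<in> I" "f \<in> P' t" for f t
  proof -
    obtain h where h: "h \<in> P t" "norm (f - h) \<le> \<delta>" using Q(3) t P'Q by blast
    have "norm f \<le> norm h + \<delta>" using h(2) norm_triangle_sub[of f h] by linarith
    moreover have "norm h + \<delta> \<le> 1 + e - e / 2 ^ Suc n" using bd h(1) t(1) by (auto simp: I_def)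
    ultimately show ?thesis by linarith
  qed
  moreover have "\<bar>f (d i) - h (d i)\<bar> \<le> (1/2) ^ n" if "f \<in> P' t" "h \<in> P' t" "i \<le> n" for f h t i
  proof -
    have "\<bar>f (d i) - k t (d i)\<bar> < (1/2) ^ Suc n" "\<bar>h (d i) - k t (d i)\<bar> < (1/2) ^ Suc n"
      using that by (auto simp: P'_def V_def)
    then have "\<bar>f (d i) - h (d i)\<bar> < (1/2) ^ Suc n + (1/2) ^ Suc n" by linarith
    then show ?thesis by simp
  qed
  moreover have "\<exists>x. norm x \<le> 1 \<and> (\<forall>t\<in>I. \<forall>f\<in>P' t. blinfun_apply f x = of_bool (t = u))"
    if "u \<in> I" for u using Q(2)[OF that] P'Q by blast
  ultimately have "stage d e n P'" by (auto simp: stage_def I_def)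
  then show ?thesis using Q(3) P'Q unfolding I_def by blast
qed

definition refines :: "real \<Rightarrow> nat \<Rightarrow> (bool list \<Rightarrow> ('a::real_normed_vector \<Rightarrow>\<^sub>L real) set) \<Rightarrow>
    (bool list \<Rightarrow> ('a \<Rightarrow>\<^sub>L real) set) \<Rightarrow> bool" where
  "refines e n P P' \<longleftrightarrow> (\<forall>t. length t = Suc n \<longrightarrow> (\<forall>f\<in>P' t. \<exists>h\<in>P (butlast t).
      norm (f - h) \<le> e / 2 ^ Suc (Suc n) \<and>
      (\<forall>y\<in>agreement {t. length t = n} P. blinfun_apply f y = h y)))"

text \<open>Both children of a node start from the set of their parent \<open>butlast t\<close>, and
  \<open>stage_from\<close> separates the two copies. With this \<open>\<delta>\<close> the old norm
  bound is \<open>1 + e - 2 * \<delta>\<close> and the new one \<open>1 + e - \<delta>\<close>,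
  which leaves room for exactly one perturbation of size \<open>\<delta>\<close>.\<close>

lemma stage_Suc:
  assumes "stage d e n P" "e > 0"
  shows "\<exists>P'. stage d e (Suc n) P' \<and> refines e n P P'"
proof -
  define \<delta> where "\<delta> = e / 2 ^ Suc (Suc n)"
  have "\<delta> > 0" using \<open>e > 0\<close> by (simp add: \<delta>_def)
  have fat: "\<forall>t. length t = Suc n \<longrightarrow> hereditarily_fat (P (butlast t))"
    using assms(1) by (simp add: stage_def)
  have "norm f + \<delta> \<le> 1 + e - e / 2 ^ Suc (Suc n)"
    if "length t = Suc n" "f \<in> P (butlast t)" for t f
  proof -
    have "length (butlast t) = n" using that(1) by simp
    then have "norm f \<le> 1 + e - e / 2 ^ Suc n"
      using assms(1) that(2) unfolding stage_def by blast
    moreover have "e / 2 ^ Suc n = \<delta> + \<delta>" by (simp add: \<delta>_def)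
    ultimately show ?thesis unfolding \<delta>_def by linarith
  qed
  then have bd: "\<forall>t. length t = Suc n \<longrightarrow>
      (\<forall>f\<in>P (butlast t). norm f + \<delta> \<le> 1 + e - e / 2 ^ Suc (Suc n))" by blast
  have sub: "agreement {t. length t = n} P \<subseteq>
      agreement {t. length t = Suc n} (\<lambda>t. P (butlast t))"
  proof
    fix y assume y: "y \<in> agreement {t. length t = n} P"
    have "blinfun_apply f y = h y"
      if "length t = Suc n" "f \<in> P (butlast t)" "h \<in> P (butlast t)" for t f h
      using that by (intro agreementD[OF y]) auto
    then show "y \<in> agreement {t. length t = Suc n} (\<lambda>t. P (butlast t))"
      unfolding agreement_def by blast
  qed
  show ?thesis
    using stage_from[of "Suc n" "\<lambda>t. P (butlast t)" \<delta> e d, OF fat \<open>\<delta> > 0\<close> bd] sub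
    unfolding refines_def \<delta>_def by (meson subsetD)
qed

lemma stage_tree:
  fixes d :: "nat \<Rightarrow> 'a::real_normed_vector"
  assumes nonsep: "\<not> separable_space (euclidean :: ('a \<Rightarrow>\<^sub>L real) topology)"
    and dense: "closure (range d) = UNIV" and "e > 0"
  obtains P where "\<And>n. stage d e n (P n)" "\<And>n. refines e n (P n) (P (Suc n))"
proof -
  \<comment> \<open>The first perturbation also has size \<open>e / 4\<close>, and the two together
    give \<open>1 + e / 2\<close>, the bound of stage 0.\<close>
  have "fat (cball (0 :: 'a \<Rightarrow>\<^sub>L real) (1 + e / 4))" using nonsep \<open>e > 0\<close> by (intro fat_cball) auto
  from fat_imp_hereditarily_fat_subset[OF dense this, of "1 + e / 4"]
  obtain S where S: "S \<subseteq> cball (0 :: 'a \<Rightarrow>\<^sub>L real) (1 + e / 4)" "hereditarily_fat S"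
    by auto
  have "norm f + e / 4 \<le> 1 + e - e / 2 ^ Suc 0" if "f \<in> S" for f
    using that S(1) \<open>e > 0\<close> by auto
  then have "\<exists>P. stage d e 0 P"
    using stage_from[of 0 "\<lambda>_. S" "e / 4" e d] S(2) \<open>e > 0\<close> by auto
  then have "\<exists>P. \<forall>n. stage d e n (P n) \<and> refines e n (P n) (P (Suc n))"
    using stage_Suc[OF _ \<open>e > 0\<close>] by (intro dependent_nat_choice) auto
  then show ?thesis using that by blast
qed

section \<open>Operators into spaces of continuous functions\<close>

lemma blinfun_of_functionals:
  fixes \<phi> :: "'c::topological_space \<Rightarrow> ('a::real_normed_vector \<Rightarrow>\<^sub>L real)"
  assumes cont: "\<And>x. continuous_on UNIV (\<lambda>s. \<phi> s x)" and bd: "\<And>s. norm (\<phi> s) \<le> M"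
  shows "\<exists>T :: 'a \<Rightarrow>\<^sub>L ('c \<Rightarrow>\<^sub>C real). norm T \<le> M \<and> (\<forall>x s. apply_bcontfun (blinfun_apply T x) s = \<phi> s x)"
proof -
  define F where "F x = Bcontfun (\<lambda>s. \<phi> s x)" for x
  have le: "norm (\<phi> s x) \<le> M * norm x" for s x
    using norm_blinfun[of "\<phi> s" x] bd[of s] by (meson mult_right_mono norm_ge_zero order_trans)
  have "(\<lambda>s. \<phi> s x) \<in> bcontfun" for x by (rule bcontfun_normI[OF cont le])
  then have F: "apply_bcontfun (F x) s = \<phi> s x" for x s by (simp add: F_def Bcontfun_inverse)
  have M: "M \<ge> 0" using bd norm_ge_zero order_trans by blast
  have nF: "norm (F x) \<le> norm x * M" for x
    using le by (intro norm_bound) (simp add: F mult.commute)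
  have "bounded_linear F"
    by (intro bounded_linear_intro[of F M] bcontfun_eqI nF)
      (simp_all add: F blinfun.add_right blinfun.scaleR_right)
  then have app: "blinfun_apply (Blinfun F) = F" by (rule bounded_linear_Blinfun_apply)
  have "norm (Blinfun F) \<le> M"
    using nF M by (intro norm_blinfun_bound) (auto simp: app mult.commute)
  then show ?thesis using F app by (intro exI[of _ "Blinfun F"]) auto
qed

text \<open>The common norm bound transfers a uniform Cauchy estimate from \<open>y\<close> to
  nearby \<open>x\<close>. The stages control oscillation only at the vectors \<open>d i\<close>, so
  convergence elsewhere has to come from density.\<close>

lemma uniformly_convergent_if_dense:
  fixes \<phi> :: "nat \<Rightarrow> 'c \<Rightarrow> ('a::real_normed_vector \<Rightarrow>\<^sub>L 'b::banach)"
  assumes bd: "\<And>n s. norm (\<phi> n s) \<le> M" and dense: "closure D = UNIV"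
    and conv: "\<And>y. y \<in> D \<Longrightarrow> uniformly_convergent_on S (\<lambda>n s. \<phi> n s y)"
  shows "uniformly_convergent_on S (\<lambda>n s. \<phi> n s x)"
  unfolding uniformly_convergent_eq_Cauchy
proof (rule uniformly_Cauchy_onI)
  have M: "M \<ge> 0" using bd norm_ge_zero order_trans by blast
  fix e :: real assume "e > 0"
  then have "e / (3 * (M + 1)) > 0" using M by simp
  then obtain y where y: "y \<in> D" "dist y x < e / (3 * (M + 1))"
    using dense by (metis UNIV_I closure_approachable)
  have near: "dist (\<phi> n s x) (\<phi> n s y) < e / 3" for n s
  proof -
    have "dist (\<phi> n s x) (\<phi> n s y) \<le> norm (\<phi> n s) * norm (x - y)"
      using norm_blinfun[of "\<phi> n s" "x - y"] by (simp add: dist_norm blinfun.diff_right)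
    also have "\<dots> \<le> (M + 1) * norm (x - y)"
      using bd[of n s] by (intro mult_right_mono) auto
    also have "\<dots> < (M + 1) * (e / (3 * (M + 1)))"
      using y M by (intro mult_strict_left_mono) (auto simp: dist_norm norm_minus_commute)
    also have "\<dots> = e / 3" using M by (simp add: field_simps)
    finally show ?thesis .
  qed
  have "e / 3 > 0" using \<open>e > 0\<close> by simp
  then obtain N where
    N: "\<forall>s\<in>S. \<forall>m\<ge>N. \<forall>n\<ge>N. dist (\<phi> m s y) (\<phi> n s y) < e / 3"
    using conv[OF y(1)] unfolding uniformly_convergent_eq_Cauchy uniformly_Cauchy_on_def by blast
  have "dist (\<phi> m s x) (\<phi> n s x) < e" if "s \<in> S" "m \<ge> N" "n \<ge> N" for s m n
  proof -
    have "dist (\<phi> m s y) (\<phi> n s y) < e / 3" using N that by blast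
    then show ?thesis
      using near[of m s] near[of n s] dist_triangle[of "\<phi> m s x" "\<phi> n s x" "\<phi> m s y"]
        dist_triangle2[of "\<phi> m s y" "\<phi> n s x" "\<phi> n s y"] by linarith
  qed
  then show "\<exists>N. \<forall>s\<in>S. \<forall>m\<ge>N. \<forall>n\<ge>N. dist (\<phi> m s x) (\<phi> n s x) < e" by blast
qed

lemma blinfun_pointwise_limit:
  fixes T :: "nat \<Rightarrow> ('a::real_normed_vector \<Rightarrow>\<^sub>L 'b::real_normed_vector)"
  assumes bd: "\<And>n. norm (T n) \<le> M" and conv: "\<And>x. convergent (\<lambda>n. T n x)"
  shows "\<exists>L. norm L \<le> M \<and> (\<forall>x. (\<lambda>n. T n x) \<longlonglongrightarrow> blinfun_apply L x)"
proof -
  have M: "M \<ge> 0" using bd norm_ge_zero order_trans by blast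
  have le: "norm (T n x) \<le> M * norm x" for n x
    using norm_blinfun[of "T n" x] bd[of n] by (meson mult_right_mono norm_ge_zero order_trans)
  define L where "L x = lim (\<lambda>n. T n x)" for x
  have L: "(\<lambda>n. T n x) \<longlonglongrightarrow> L x" for x
    using conv[of x] by (simp add: L_def convergent_LIMSEQ_iff)
  have nL: "norm (L x) \<le> norm x * M" for x
    using L[of x] le by (intro LIMSEQ_le_const2[OF tendsto_norm]) (auto simp: mult.commute)
  have "bounded_linear L"
  proof (rule bounded_linear_intro[OF _ _ nL])
    show "L (x + y) = L x + L y" for x y
      using tendsto_add[OF L L] L[of "x + y"]
      by (intro LIMSEQ_unique) (auto simp: blinfun.add_right)
    show "L (r *\<^sub>R x) = r *\<^sub>R L x" for r x
      using tendsto_scaleR[OF tendsto_const L] L[of "r *\<^sub>R x"]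
      by (intro LIMSEQ_unique) (auto simp: blinfun.scaleR_right)
  qed
  then have app: "blinfun_apply (Blinfun L) = L" by (rule bounded_linear_Blinfun_apply)
  have "norm (Blinfun L) \<le> M"
    using nL M by (intro norm_blinfun_bound) (auto simp: app mult.commute)
  then show ?thesis using L app by (intro exI[of _ "Blinfun L"]) auto
qed

text \<open>Weierstrass M-test applied to the telescoping sum. The estimate may start at an index
  \<open>m\<close> because the increments at \<open>d i\<close> are controlled only from stage
  \<open>i\<close> on.\<close>

lemma uniformly_convergent_if_geometric_increments:
  fixes a :: "nat \<Rightarrow> 'c \<Rightarrow> 'b::banach"
  assumes incr: "\<And>n s. n \<ge> m \<Longrightarrow> s \<in> S \<Longrightarrow> norm (a (Suc n) s - a n s) \<le> K * (1/2) ^ n"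
  shows "uniformly_convergent_on S a"
proof -
  have "summable (\<lambda>n. K * (1/2 :: real) ^ n)" by (intro summable_mult summable_geometric) simp
  moreover have "\<forall>\<^sub>F n in sequentially. \<forall>s\<in>S. norm (a (Suc n) s - a n s) \<le> K * (1/2) ^ n"
    using incr by (intro eventually_sequentiallyI[of m]) blast
  ultimately have "uniformly_convergent_on S (\<lambda>n s. \<Sum>i<n. a (Suc i) s - a i s)"
    by (intro Weierstrass_m_test'_ev)
  then obtain l where "uniform_limit S (\<lambda>n s. \<Sum>i<n. a (Suc i) s - a i s) l sequentially"
    unfolding uniformly_convergent_on_def by blast
  then have "uniform_limit S (\<lambda>n s. (\<Sum>i<n. a (Suc i) s - a i s) + a 0 s)
      (\<lambda>s. l s + a 0 s) sequentially"
    by (rule uniform_limit_add) (rule uniform_limit_const)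
  moreover have "(\<Sum>i<n. a (Suc i) s - a i s) + a 0 s = a n s" for n s
    using sum_lessThan_telescope[of "\<lambda>i. a i s" n] by simp
  ultimately have "uniform_limit S a (\<lambda>s. l s + a 0 s) sequentially" by simp
  then show ?thesis by (rule uniformly_convergentI)
qed

text \<open>The last coordinate used splits the Cantor set into two closed pieces, on each of which
  the function depends on one coordinate fewer.\<close>

lemma continuous_on_initial_segment:
  fixes F :: "bool list \<Rightarrow> 'b::topological_space"
  shows "continuous_on UNIV (\<lambda>s :: cantor. F (map s [0..<n]))"
proof (induction n arbitrary: F)
  case 0
  then show ?case by simp
next
  case (Suc n)
  have cl: "closed {s :: cantor. s n = b}" for b
  proof -
    have "closed ((\<lambda>s :: cantor. s n) -` {b})"
      by (intro closed_vimage continuous_on_product_coordinates) auto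
    then show ?thesis by (simp add: vimage_def)
  qed
  have c: "continuous_on {s :: cantor. s n = b} (\<lambda>s. F (map s [0..<Suc n]))" for b
    using continuous_on_subset[OF Suc.IH[of "\<lambda>t. F (t @ [b])"] subset_UNIV]
    by (rule continuous_on_eq) auto
  have "continuous_on ({s :: cantor. s n = True} \<union> {s. s n = False}) (\<lambda>s. F (map s [0..<Suc n]))"
    by (intro continuous_on_closed_Un cl c)
  moreover have "{s :: cantor. s n = True} \<union> {s. s n = False} = UNIV" by auto
  ultimately show ?case by simp
qed

lemma chiDelta_eq: "chiDelta t s = of_bool (map s [0..<length t] = t)"
proof -
  have "(map s [0..<length t] = t) = (s \<in> Delta t)"
    unfolding Delta_def list_eq_iff_nth_eq by simp
  then show ?thesis by (simp add: chiDelta_def indicator_def)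
qed

lemma dense_sequence:
  fixes dummy :: "'b::topological_space"
  assumes "separable_space (euclidean :: 'b topology)"
  obtains d :: "nat \<Rightarrow> 'b" where "closure (range d) = UNIV"
proof -
  obtain D :: "'b set" where D: "countable D" "closure D = UNIV"
    using assms unfolding separable_space_def by auto
  then have "D \<noteq> {}" by auto
  then have "range (from_nat_into D) = D" using D(1) by (rule range_from_nat_into)
  then show ?thesis using D(2) that by metis
qed

section \<open>Limits along the branches of the tree\<close>

lemma exists_operator_hitting_chiDelta:
  fixes dummy :: "'a::banach"
  assumes sepX: "separable_space (euclidean :: 'a topology)"
    and nonsep: "\<not> separable_space (euclidean :: ('a \<Rightarrow>\<^sub>L real) topology)" and "e > 0"
  shows "\<exists>T :: 'a \<Rightarrow>\<^sub>L (cantor \<Rightarrow>\<^sub>C real). norm T \<le> 1 + e \<and>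
    (\<forall>t. \<exists>x. norm x \<le> 1 \<and> apply_bcontfun (blinfun_apply T x) = chiDelta t)"
proof -
  obtain d :: "nat \<Rightarrow> 'a" where dense: "closure (range d) = UNIV"
    using dense_sequence[OF sepX] by blast
  obtain P where P: "\<And>n. stage d e n (P n)" "\<And>n. refines e n (P n) (P (Suc n))"
    using stage_tree[OF nonsep dense \<open>e > 0\<close>] by blast
  \<comment> \<open>Any member serves: different choices differ little at the vectors
    \<open>d i\<close> and agree at the isolating vectors.\<close>
  define p where "p n t = (SOME f. f \<in> P n t)" for n t
  define \<phi> where "\<phi> n s = p n (map s [0..<n])" for n and s :: cantor
  have p: "p n t \<in> P n t" if "length t = n" for n t
    using P(1)[of n] that hereditarily_fat_nonempty unfolding stage_def p_def
    by (metis all_not_in_conv someI_ex)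
  have \<phi>: "\<phi> n s \<in> P n (map s [0..<n])" for n s unfolding \<phi>_def by (rule p) simp
  have norm_\<phi>: "norm (\<phi> n s) \<le> 1 + e" for n s
  proof -
    have "length (map s [0..<n]) = n" by simp
    then have "norm (\<phi> n s) \<le> 1 + e - e / 2 ^ Suc n"
      using P(1)[of n] \<phi>[of n s] unfolding stage_def by blast
    moreover have "e / 2 ^ Suc n \<ge> 0" using \<open>e > 0\<close> by simp
    ultimately show ?thesis by linarith
  qed
  \<comment> \<open>The comparison passes through a member \<open>h\<close> of the parent set: the
    first difference is bounded by the perturbation, the second by the oscillation of
    \<open>P n\<close>, which covers \<open>d i\<close> for \<open>i \<le> n\<close>.\<close>
  have step: "\<bar>\<phi> (Suc n) s (d i) - \<phi> n s (d i)\<bar> \<le> (e * norm (d i) + 1) * (1/2) ^ n"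
    if "i \<le> n" for n s i
  proof -
    have len: "length (map s [0..<Suc n]) = Suc n" "length (map s [0..<n]) = n"
      and bl: "butlast (map s [0..<Suc n]) = map s [0..<n]" by simp_all
    obtain h where h: "h \<in> P n (map s [0..<n])" "norm (\<phi> (Suc n) s - h) \<le> e / 2 ^ Suc (Suc n)"
      using P(2)[of n, unfolded refines_def, rule_format, OF len(1) \<phi>] bl by metis
    have "\<bar>\<phi> (Suc n) s (d i) - h (d i)\<bar> \<le> norm (\<phi> (Suc n) s - h) * norm (d i)"
      using norm_blinfun[of "\<phi> (Suc n) s - h" "d i"] by (simp add: blinfun.diff_left)
    also have "\<dots> \<le> e / 2 ^ Suc (Suc n) * norm (d i)" using h(2) by (rule mult_right_mono) simp
    also have "\<dots> \<le> e / 2 ^ n * norm (d i)"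
      using \<open>e > 0\<close> by (intro mult_right_mono divide_left_mono) auto
    finally have 1: "\<bar>\<phi> (Suc n) s (d i) - h (d i)\<bar> \<le> e * norm (d i) * (1/2) ^ n"
      by (simp add: power_one_over)
    have 2: "\<bar>h (d i) - \<phi> n s (d i)\<bar> \<le> (1/2) ^ n"
      using P(1)[of n] len(2) h(1) \<phi>[of n s] that unfolding stage_def by blast
    show ?thesis using 1 2 unfolding distrib_right by linarith
  qed
  \<comment> \<open>At the vector isolating \<open>u\<close> the values are constant from stage
    \<open>length u\<close> on, so the limit equals the indicator exactly.\<close>
  have hit: "\<exists>x. norm x \<le> 1 \<and> (\<forall>m\<ge>length u. \<forall>s. \<phi> m s x = chiDelta u s)" for u
  proof -
    define n where "n = length u"
    obtain x where x: "norm x \<le> 1"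
        "\<And>t f. length t = n \<Longrightarrow> f \<in> P n t \<Longrightarrow> blinfun_apply f x = of_bool (t = u)"
      using P(1)[of n] n_def unfolding stage_def by metis
    \<comment> \<open>The claim concerns all members of the sets, not only the chosen ones: this
      places \<open>x\<close> in the agreement set of stage \<open>m\<close>, so the next
      perturbation does not change its values.\<close>
    have val: "blinfun_apply f x = of_bool (take n t = u)"
      if "m \<ge> n" "length t = m" "f \<in> P m t" for m t f
      using that
    proof (induction m arbitrary: t f rule: dec_induct)
      case base
      then show ?case using x(2) by simp
    next
      case (step m)
      have "x \<in> agreement {t. length t = m} (P m)"
        using step.IH by (simp add: agreement_def)
      then obtain h where h: "h \<in> P m (butlast t)" "blinfun_apply f x = h x"
        using P(2)[of m, unfolded refines_def, rule_format, OF step.prems] by blast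
      moreover have "take n (butlast t) = take n t"
        using step by (intro take_butlast) simp
      ultimately show ?case using step.IH[of "butlast t" h] step.prems(1) by simp
    qed
    have "\<phi> m s x = chiDelta u s" if "m \<ge> n" for m s
      using val[OF that _ \<phi>, of s] that by (simp add: chiDelta_eq n_def take_map)
    then show ?thesis using x(1) by (auto simp: n_def)
  qed
  have "uniformly_convergent_on UNIV (\<lambda>n s. \<phi> n s y)" if "y \<in> range d" for y
  proof -
    obtain i where i: "y = d i" using \<open>y \<in> range d\<close> by blast
    have "norm (\<phi> (Suc n) s y - \<phi> n s y) \<le> (e * norm (d i) + 1) * (1/2) ^ n"
      if "n \<ge> i" for n s using step[OF that] by (simp add: i)
    then show ?thesis
      by (rule uniformly_convergent_if_geometric_increments[of i UNIV "\<lambda>n s. \<phi> n s y"])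
  qed
  note uconv = uniformly_convergent_if_dense[of \<phi>, OF norm_\<phi> dense this]
  have "convergent (\<lambda>n. \<phi> n s x)" for s x
    using uniformly_convergent_on_subset[OF uconv[of x], of "{s}"]
    by (simp add: uniformly_convergent_on_singleton)
  then have "\<exists>L. norm L \<le> 1 + e \<and> (\<forall>x. (\<lambda>n. \<phi> n s x) \<longlonglongrightarrow> blinfun_apply L x)" for s
    using blinfun_pointwise_limit[of "\<lambda>n. \<phi> n s", OF norm_\<phi>] by blast
  then obtain L where L: "\<And>s. norm (L s) \<le> 1 + e"
      "\<And>s x. (\<lambda>n. \<phi> n s x) \<longlonglongrightarrow> blinfun_apply (L s) x"
    by metis
  have "continuous_on UNIV (\<lambda>s. L s x)" for x
  proof (rule uniform_limit_theorem)
    have "lim (\<lambda>n. \<phi> n s x) = L s x" for s using L(2) by (rule limI)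
    then show "uniform_limit UNIV (\<lambda>n s. \<phi> n s x) (\<lambda>s. L s x) sequentially"
      using uconv[of x] unfolding uniformly_convergent_uniform_limit_iff by simp
    show "\<forall>\<^sub>F n in sequentially. continuous_on UNIV (\<lambda>s. \<phi> n s x)"
      unfolding \<phi>_def by (intro always_eventually allI continuous_on_initial_segment)
  qed simp
  from blinfun_of_functionals[OF this L(1)] obtain T :: "'a \<Rightarrow>\<^sub>L (cantor \<Rightarrow>\<^sub>C real)"
    where T: "norm T \<le> 1 + e" "\<And>x s. apply_bcontfun (blinfun_apply T x) s = L s x" by blast
  have "\<exists>x. norm x \<le> 1 \<and> apply_bcontfun (blinfun_apply T x) = chiDelta u" for u
  proof -
    obtain x where x: "norm x \<le> 1" "\<And>m s. m \<ge> length u \<Longrightarrow> \<phi> m s x = chiDelta u s"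
      using hit[of u] by blast
    have "(\<lambda>n. \<phi> n s x) \<longlonglongrightarrow> chiDelta u s" for s
      using x(2) by (intro tendsto_eventually eventually_sequentiallyI)
    then have "L s x = chiDelta u s" for s using L(2) LIMSEQ_unique by blast
    then show ?thesis using x(1) T(2) by (intro exI[of _ x]) auto
  qed
  then show ?thesis using T(1) by blast
qed

section \<open>The Haar system\<close>

lemma chiDelta_Nil: "chiDelta [] = haar0"
  by (simp add: chiDelta_def Delta_def haar0_def)

lemma haar_operator:
  fixes T :: "'a::real_normed_vector \<Rightarrow>\<^sub>L (cantor \<Rightarrow>\<^sub>C real)"
  assumes T: "\<And>t. \<exists>x. norm x \<le> 1 \<and> apply_bcontfun (blinfun_apply T x) = chiDelta t"
  shows "\<exists>x. norm x \<le> 1 \<and> apply_bcontfun (blinfun_apply (2 *\<^sub>R T) x) = haar0"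
    and "\<exists>x. norm x \<le> 1 \<and> apply_bcontfun (blinfun_apply (2 *\<^sub>R T) x) = haar t"
proof -
  obtain x where x: "norm x \<le> 1" "apply_bcontfun (blinfun_apply T x) = haar0"
    using T[of "[]"] chiDelta_Nil by metis
  show "\<exists>x. norm x \<le> 1 \<and> apply_bcontfun (blinfun_apply (2 *\<^sub>R T) x) = haar0"
    \<comment> \<open>Here \<open>haar0\<close> is the indicator belonging to the empty word, and
      halving \<open>x\<close> cancels the factor 2.\<close>
    using x by (intro exI[of _ "(1/2) *\<^sub>R x"])
      (auto simp: fun_eq_iff blinfun.scaleR_left blinfun.scaleR_right)
  obtain y where y: "norm y \<le> 1" "apply_bcontfun (blinfun_apply T y) = chiDelta (t @ [False])"
    using T by blast
  obtain z where z: "norm z \<le> 1" "apply_bcontfun (blinfun_apply T z) = chiDelta (t @ [True])"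
    using T by blast
  have "norm ((1/2) *\<^sub>R (y - z)) \<le> 1" using norm_triangle_ineq4[of y z] y(1) z(1) by simp
  moreover have "apply_bcontfun (blinfun_apply (2 *\<^sub>R T) ((1/2) *\<^sub>R (y - z))) = haar t"
    using y(2) z(2) by (simp add: fun_eq_iff blinfun.scaleR_left blinfun.scaleR_right
        blinfun.diff_right haar_def)
  ultimately show "\<exists>x. norm x \<le> 1 \<and> apply_bcontfun (blinfun_apply (2 *\<^sub>R T) x) = haar t" by blast
qed

section \<open>From Haar functions to a non-separable dual\<close>

lemma uncountable_cantor: "uncountable (UNIV :: cantor set)"
proof
  assume "countable (UNIV :: cantor set)"
  then have "range (from_nat_into (UNIV :: cantor set)) = UNIV" by (intro range_from_nat_into) auto
  \<comment> \<open>The diagonal sequence differs from the \<open>n\<close>-th sequence at place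
    \<open>n\<close>.\<close>
  then obtain n where "(\<lambda>k. \<not> from_nat_into UNIV k k) = from_nat_into (UNIV :: cantor set) n"
    by (metis UNIV_I imageE)
  then show False by metis
qed

text \<open>Take \<open>t\<close> to be the longest common initial segment: one of the points lies
  in the positive half of \<open>haar t\<close> and the other in the negative half.\<close>

lemma haar_separates:
  assumes "s \<noteq> s'"
  obtains t where "\<bar>haar t s - haar t s'\<bar> = 2"
proof -
  define n where "n = (LEAST n. s n \<noteq> s' n)"
  obtain k where "s k \<noteq> s' k" using assms unfolding fun_eq_iff by blast
  then have n: "s n \<noteq> s' n" unfolding n_def by (rule LeastI)
  have less: "s i = s' i" if "i < n" for i
    using not_less_Least[of i "\<lambda>k. s k \<noteq> s' k"] that by (simp add: n_def)
  define t where "t = map s [0..<n]"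
  have s': "map s' [0..<n] = t" using less by (auto simp: t_def)
  have "chiDelta (t @ [b]) r = of_bool (r n = b)" if "map r [0..<n] = t" for b r
    using that by (simp add: chiDelta_eq t_def)
  then have "haar t r = of_bool (\<not> r n) - of_bool (r n)" if "map r [0..<n] = t" for r
    using that by (simp add: haar_def)
  from this[OF s'] this[of s] have "\<bar>haar t s - haar t s'\<bar> = 2"
    using n t_def by (cases "s n") auto
  then show ?thesis by (rule that)
qed

text \<open>The functionals \<open>\<psi> s\<close> are pairwise at distance at least 2, since a
  preimage of a separating Haar function lies in the unit ball. Choosing for each \<open>s\<close>
  the index of a term of a dense sequence within distance 1 would then inject the Cantor set into
  the naturals.\<close>

lemma haar_operator_imp_nonseparable_dual:
  fixes R :: "'a::real_normed_vector \<Rightarrow>\<^sub>L (cantor \<Rightarrow>\<^sub>C real)"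
  assumes R: "\<And>t. \<exists>x. norm x \<le> 1 \<and> apply_bcontfun (blinfun_apply R x) = haar t"
  shows "\<not> separable_space (euclidean :: ('a \<Rightarrow>\<^sub>L real) topology)"
proof
  assume "separable_space (euclidean :: ('a \<Rightarrow>\<^sub>L real) topology)"
  then obtain d :: "nat \<Rightarrow> 'a \<Rightarrow>\<^sub>L real" where dense: "closure (range d) = UNIV"
    by (rule dense_sequence)
  define \<psi> where "\<psi> s = Blinfun (\<lambda>x. R x s)" for s
  have "bounded_linear (\<lambda>x. R x s)" for s
  proof (rule bounded_linear_intro)
    show "norm (R x s) \<le> norm x * norm R" for x
      using norm_bounded[of "R x" s] norm_blinfun[of R x] by (simp add: mult.commute)
  qed (simp_all add: blinfun.add_right blinfun.scaleR_right)
  then have \<psi>: "\<psi> s x = R x s" for s x by (simp add: \<psi>_def bounded_linear_Blinfun_apply)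
  have sep: "dist (\<psi> s) (\<psi> s') \<ge> 2" if ne: "s \<noteq> s'" for s s'
  proof -
    obtain t where t: "\<bar>haar t s - haar t s'\<bar> = 2" using haar_separates[OF ne] by blast
    obtain x where x: "norm x \<le> 1" "apply_bcontfun (blinfun_apply R x) = haar t" using R by blast
    have "2 = norm ((\<psi> s - \<psi> s') x)" using t x(2) by (simp add: \<psi> blinfun.diff_left)
    also have "\<dots> \<le> norm (\<psi> s - \<psi> s') * norm x" by (rule norm_blinfun)
    also have "\<dots> \<le> norm (\<psi> s - \<psi> s') * 1" using x(1) by (intro mult_left_mono) auto
    finally show ?thesis by (simp add: dist_norm)
  qed
  have "\<exists>i. dist (d i) (\<psi> s) < 1" for s
    using dense by (metis UNIV_I closure_approachable rangeE zero_less_one)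
  then obtain i where i: "\<And>s. dist (d (i s)) (\<psi> s) < 1" by metis
  have "inj i"
  proof (rule injI, rule ccontr)
    fix s s' assume "i s = i s'" "s \<noteq> s'"
    then show False using i[of s] i[of s'] sep[of s s']
      dist_triangle2[of "\<psi> s" "\<psi> s'" "d (i s)"] by (simp add: dist_commute)
  qed
  then have "countable (UNIV :: cantor set)" by (rule countableI)
  then show False using uncountable_cantor by contradiction
qed

theorem theorem6p1:
  fixes dummy :: "'a::banach"
  assumes sepX: "separable_space (euclidean :: 'a topology)"
  shows "(\<not> separable_space (euclidean :: ('a \<Rightarrow>\<^sub>L real) topology))
     = (\<forall>\<epsilon>>0. \<exists>T :: 'a \<Rightarrow>\<^sub>L (cantor \<Rightarrow>\<^sub>C real).
            norm T \<le> 1 + \<epsilon> \<and>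
            (\<forall>t. \<exists>x. norm x \<le> 1 \<and> apply_bcontfun (blinfun_apply T x) = chiDelta t))
   \<and> (\<not> separable_space (euclidean :: ('a \<Rightarrow>\<^sub>L real) topology))
     = (\<forall>\<epsilon>>0. \<exists>R :: 'a \<Rightarrow>\<^sub>L (cantor \<Rightarrow>\<^sub>C real).
            norm R \<le> 2 + \<epsilon> \<and>
            (\<exists>x. norm x \<le> 1 \<and> apply_bcontfun (blinfun_apply R x) = haar0) \<and>
            (\<forall>t. \<exists>x. norm x \<le> 1 \<and> apply_bcontfun (blinfun_apply R x) = haar t))"
    (is "?i = ?ii \<and> ?i = ?iii")
proof -
  \<comment> \<open>The three implications form a cycle from (i) through (ii) and (iii) back to
    (i).\<close>
  have "?i \<Longrightarrow> ?ii" using exists_operator_hitting_chiDelta[OF sepX] by blast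
  moreover have "?ii \<Longrightarrow> ?iii"
  proof (intro allI impI)
    fix \<epsilon> :: real assume ii: ?ii and "\<epsilon> > 0"
    \<comment> \<open>Doubling \<open>T\<close> doubles its norm bound, hence the choice of
      \<open>\<epsilon> / 2\<close>.\<close>
    then obtain T :: "'a \<Rightarrow>\<^sub>L (cantor \<Rightarrow>\<^sub>C real)" where T: "norm T \<le> 1 + \<epsilon> / 2"
        "\<And>t. \<exists>x. norm x \<le> 1 \<and> apply_bcontfun (blinfun_apply T x) = chiDelta t"
      by (meson half_gt_zero)
    have "norm (2 *\<^sub>R T) \<le> 2 + \<epsilon>" using T(1) by simp
    then show "\<exists>R :: 'a \<Rightarrow>\<^sub>L (cantor \<Rightarrow>\<^sub>C real). norm R \<le> 2 + \<epsilon> \<and>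
        (\<exists>x. norm x \<le> 1 \<and> apply_bcontfun (blinfun_apply R x) = haar0) \<and>
        (\<forall>t. \<exists>x. norm x \<le> 1 \<and> apply_bcontfun (blinfun_apply R x) = haar t)"
      using haar_operator[OF T(2)] by blast
  qed
  \<comment> \<open>One operator suffices here, the one for \<open>\<epsilon> = 1\<close>.\<close>
  moreover have "?iii \<Longrightarrow> ?i"
    using haar_operator_imp_nonseparable_dual zero_less_one by meson
  ultimately show ?thesis by blast
qed

end
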